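(* Let $L\ge2$, $n\ge1$ be integers, $m=n(L-1)$, let $f_0(w)=1$ and $f_i(w)=\sum_{j\ge0}a^i_jw^j\in\mathbb{C}[\![w]\!]$ $(1\le i\le L-1)$, and let $(P_i^{(j)}(w))_{0\le i\le L-1}$, for $0\le j\le L-1$, be the simultaneous Padé polynomials of $f_0,\dots,f_{L-1}$ (see the context). Then the polynomials $P_0^{(j)}$ admit the following determinantal representations, for some normalizing (nonzero) constants ${\rm NP}^{(j)}$: $$P_0^{(0)}(w)=\frac{1}{{\rm NP}^{(0)}}\det\begin{bmatrix}1,w,w^2,\dots,w^m\\ A^1_m(n,m+1)\\ \vdots\\ A^{L-1}_m(n,m+1)\end{bmatrix}$$ and, for $1\le j\le L-1$, $$P_0^{(j)}(w)=\frac{1}{{\rm NP}^{(j)}}\det\begin{bmatrix}1,w,w^2,\dots,w^{m-1}\\ A^1_m(n,m)\\ \vdots\\ A^{j-1}_m(n,m)\\ A^j_m(n-1,m)\\ A^{j+1}_{m-1}(n,m)\\ \vdots\\ A^{L-1}_{m-1}(n,m)\end{bmatrix}.$$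
   Context: $A^i_j(k,l)$ denotes the $k\times l$ rectangular Toeplitz matrix whose $(r,s)$ entry is $a^i_{j+r-s}$ $(1\le r\le k,\ 1\le s\le l)$, with $a^i_j=0$ for $j<0$ (the superscript $i$ is an index); a matrix with $0$ rows is empty. For each $0\le j\le L-1$, $(P^{(j)}_i)_{0\le i\le L-1}$ is a nontrivial tuple of polynomials in $w$ with $\deg P_i^{(j)}\le n(L-1)-1+\delta_{i,j}$ ($\delta_{i,j}$ the Kronecker delta) such that: if $j=0$, $f_0P_i^{(0)}-f_iP_0^{(0)}=O(w^{nL})$ for $1\le i\le L-1$; if $1\le j\le L-1$, $f_0P_i^{(j)}-f_iP_0^{(j)}=O(w^{nL})$ for $1\le i\le j-1$ and $f_0P_i^{(j)}-f_i\,wP_0^{(j)}=O(w^{nL})$ for $j\le i\le L-1$. It is assumed (generic condition) that for each $j$ this tuple is unique up to simultaneous multiplication by constants; equivalently, the matrices obtained by deleting the top row from the matrices in the determinants above have full rank $m$ (for $j=0$) and $m-1$ (for $1\le j\le L-1$). *)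

theory Defs
  imports
    "Jordan_Normal_Form.Determinant"
    "HOL-Computational_Algebra.Polynomial_FPS"
begin

no_notation fps_nth (infixl \<open>$\<close> 75)

definition fps_nth_int :: "'a::zero fps \<Rightarrow> int \<Rightarrow> 'a" where
  "fps_nth_int f j = (if j < 0 then 0 else fps_nth f (nat j))"

text \<open>
  The \<open>k \<times> l\<close> Toeplitz matrix \<open>A\<^sub>j(k,l)\<close> of the coefficients of \<open>f\<close>. Its entry in the
  \<open>r\<close>-th row and \<open>s\<close>-th column is the coefficient of index \<open>j + r - s\<close>; this is the same
  whether rows and columns are counted from 1 or, as here, from 0. The index can be negative.
\<close>
definition toeplitz :: "'a::zero fps \<Rightarrow> nat \<Rightarrow> nat \<Rightarrow> nat \<Rightarrow> 'a mat" where
  "toeplitz f j k l = mat k l (\<lambda>(r, s). fps_nth_int f (int j + int r - int s))"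

text \<open>The assertion \<open>g = O(w\<^sup>N)\<close> for a formal power series.\<close>
definition vanishes_to_order :: "nat \<Rightarrow> 'a::zero fps \<Rightarrow> bool" where
  "vanishes_to_order N g \<longleftrightarrow> (\<forall>k<N. fps_nth g k = 0)"

text \<open>
  \<open>Q\<close> is a tuple of simultaneous Pade polynomials of type \<open>j\<close> for \<open>f 0, \<dots>, f (L - 1)\<close>. Only the
  values \<open>Q i\<close> and \<open>f i\<close> with \<open>i < L\<close> are relevant.
\<close>
definition pade_tuple ::
  "nat \<Rightarrow> nat \<Rightarrow> (nat \<Rightarrow> complex fps) \<Rightarrow> nat \<Rightarrow> (nat \<Rightarrow> complex poly) \<Rightarrow> bool" where
  "pade_tuple L n f j Q \<longleftrightarrow>
     (\<exists>i<L. Q i \<noteq> 0) \<and>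
     (\<forall>i<L. degree (Q i) \<le> n * (L - 1) - 1 + (if i = j then 1 else 0)) \<and>
     (if j = 0 then
        \<forall>i\<in>{1..<L}. vanishes_to_order (n * L)
          (f 0 * fps_of_poly (Q i) - f i * fps_of_poly (Q 0))
      else
        (\<forall>i\<in>{1..<j}. vanishes_to_order (n * L)
          (f 0 * fps_of_poly (Q i) - f i * fps_of_poly (Q 0))) \<and>
        (\<forall>i\<in>{j..<L}. vanishes_to_order (n * L)
          (f 0 * fps_of_poly (Q i) - f i * (fps_X * fps_of_poly (Q 0)))))"

definition unique_pade_tuple :: "nat \<Rightarrow> nat \<Rightarrow> (nat \<Rightarrow> complex fps) \<Rightarrow> nat \<Rightarrow> bool" where
  "unique_pade_tuple L n f j \<longleftrightarrow>
     (\<forall>Q R. pade_tuple L n f j Q \<longrightarrow> pade_tuple L n f j R \<longrightarrow>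
        (\<exists>c. \<forall>i<L. R i = smult c (Q i)))"

text \<open>
  The matrix of polynomials with \<open>l\<close> columns whose top row is \<open>1, w, \<dots>, w\<^sup>l\<^sup>-\<^sup>1\<close>, followed by the
  rows of the given matrices of constants, one below the other.
\<close>
definition powers_over_blocks :: "nat \<Rightarrow> complex mat list \<Rightarrow> complex poly mat" where
  "powers_over_blocks l As =
     mat_of_rows l (vec l (\<lambda>s. monom 1 s) # map (map_vec (\<lambda>c. [:c:])) (concat (map rows As)))"

definition pade_matrix :: "nat \<Rightarrow> nat \<Rightarrow> (nat \<Rightarrow> complex fps) \<Rightarrow> nat \<Rightarrow> complex poly mat" where
  "pade_matrix L n f j =
     (let m = n * (L - 1) in
      if j = 0 then
        powers_over_blocks (m + 1) (map (\<lambda>i. toeplitz (f i) m n (m + 1)) [1..<L])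
      else
        powers_over_blocks m
          (map (\<lambda>i. toeplitz (f i) m n m) [1..<j] @
           [toeplitz (f j) m (n - 1) m] @
           map (\<lambda>i. toeplitz (f i) (m - 1) n m) [j + 1..<L]))"

text \<open>The library's determinant is 0 on matrices that are not square; these ones are square.\<close>

lemma toeplitz_dim [simp]:
  "dim_row (toeplitz f j k l) = k" "dim_col (toeplitz f j k l) = l"
  by (simp_all add: toeplitz_def)

lemma powers_over_blocks_dim [simp]:
  "dim_row (powers_over_blocks l As) = Suc (\<Sum>A\<leftarrow>As. dim_row A)"
  "dim_col (powers_over_blocks l As) = l"
  by (simp_all add: powers_over_blocks_def length_concat o_def)

lemma pade_matrix_0_carrier:
  "pade_matrix L n f 0 \<in> carrier_mat (n * (L - 1) + 1) (n * (L - 1) + 1)"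
  by (rule carrier_matI) (simp_all add: pade_matrix_def Let_def o_def sum_list_triv)

lemma pade_matrix_carrier:
  assumes "1 \<le> n" "1 \<le> j" "j < L"
  shows "pade_matrix L n f j \<in> carrier_mat (n * (L - 1)) (n * (L - 1))"
proof -
  obtain d where L: "L = j + 1 + d" using assms(3) less_imp_add_positive
    by (metis Suc_eq_plus1 Suc_leI le_Suc_ex)
  obtain i where j: "j = Suc i" using assms(2) by (cases j) auto
  obtain k where n: "n = Suc k" using assms(1) by (cases n) auto
  show ?thesis
    by (rule carrier_matI)
      (simp_all add: pade_matrix_def Let_def o_def sum_list_triv L j n algebra_simps del: upt_Suc)
qed

end

theory Submission
  imports Defs
begin

text \<open>
  Since \<open>f 0 = 1\<close>, the conditions on a Pade tuple say that each \<open>P i\<close> with \<open>i \<ge> 1\<close> is a truncation of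
  \<open>f i * P 0\<close> (or of \<open>w * f i * P 0\<close>), and that the coefficients of this series between the degree
  bound of \<open>P i\<close> and the order \<open>n * L\<close> vanish. The latter are homogeneous linear equations for the
  coefficients of \<open>P 0\<close>, and their matrix consists of the rows of the determinant below the top one.
  By uniqueness of the tuple the solutions form a line, and the vector of cofactors of the top row,
  i.e. the coefficient vector of the determinant, is a nonzero element of it.
\<close>

section \<open>Cofactors along the top row\<close>

lemma cofactor_mat_of_rows_Cons:
  assumes "Suc (length rs) = N" and "s < N"
  shows "cofactor (mat_of_rows N (u # rs)) 0 s = cofactor (mat_of_rows N (v # rs)) 0 s"
proof -
  have "mat_delete (mat_of_rows N (u # rs)) 0 s = mat_delete (mat_of_rows N (v # rs)) 0 s"
    by (rule eq_matI) (simp_all add: mat_delete_def mat_of_rows_def)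
  then show ?thesis by (simp add: cofactor_def)
qed

text \<open>Laplace expansion along row 0. The cofactors do not see that row, so they can be taken
  from any top row \<open>v\<close>; thus the determinant is a fixed linear form in
  \<open>u\<close>.\<close>

lemma det_mat_of_rows_Cons:
  fixes u :: "'a::comm_ring_1 vec"
  assumes "Suc (length rs) = N"
  shows "det (mat_of_rows N (u # rs)) =
    (\<Sum>s<N. u $ s * cofactor (mat_of_rows N (v # rs)) 0 s)"
proof -
  have "det (mat_of_rows N (u # rs)) =
      (\<Sum>s<N. mat_of_rows N (u # rs) $$ (0, s) * cofactor (mat_of_rows N (u # rs)) 0 s)"
    by (rule laplace_expansion_row) (use assms in \<open>auto intro!: carrier_matI\<close>)
  also have "\<dots> = (\<Sum>s<N. u $ s * cofactor (mat_of_rows N (v # rs)) 0 s)"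
    by (rule sum.cong)
      (simp_all add: mat_of_rows_index cofactor_mat_of_rows_Cons[OF assms, of _ u v])
  finally show ?thesis .
qed

text \<open>
  Replacing the top row by one of the rows below it gives determinant 0, so the vector of cofactors
  is annihilated by these rows. It is not 0: if \<open>p $ t \<noteq> 0\<close>, then the matrix with the \<open>t\<close>-th
  unit vector as its top row is invertible, and its determinant is the \<open>t\<close>-th cofactor.
\<close>
lemma cofactor_top_row_proportional:
  fixes rs :: "'a::field vec list"
  assumes len: "Suc (length rs) = N" and rs: "set rs \<subseteq> carrier_vec N"
    and p: "p \<in> carrier_vec N" "p \<noteq> 0\<^sub>v N"
    and ker: "\<And>v. v \<in> carrier_vec N \<Longrightarrow> (\<And>r. r \<in> set rs \<Longrightarrow> r \<bullet> v = 0) \<Longrightarrow> \<exists>c. v = c \<cdot>\<^sub>v p"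
  obtains k where "k \<noteq> 0"
    and "\<And>s. s < N \<Longrightarrow> cofactor (mat_of_rows N (u # rs)) 0 s = k * p $ s"
proof -
  define M where "M v = mat_of_rows N (v # rs)" for v
  have M: "M v \<in> carrier_mat N N" for v
    using len by (auto simp: M_def intro!: carrier_matI)
  define c where "c = vec N (cofactor (M u) 0)"
  have det_M: "det (M v) = v \<bullet> c" for v
    unfolding M_def det_mat_of_rows_Cons[OF len, of v u] c_def
    by (auto simp: scalar_prod_def M_def atLeast0LessThan)
  have "r \<bullet> c = 0" if r: "r \<in> set rs" for r
  proof -
    obtain i where i: "i < length rs" "rs ! i = r" using r by (auto simp: in_set_conv_nth)
    have "row (M r) 0 = row (M r) (Suc i)"
      using i len by (intro eq_vecI) (simp_all add: M_def mat_of_rows_index)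
    then have "det (M r) = 0"
      using det_identical_rows[OF M, of 0 "Suc i"] i len by simp
    then show ?thesis by (simp add: det_M)
  qed
  then obtain k where k: "c = k \<cdot>\<^sub>v p"
    using ker[of c] by (auto simp: c_def)
  obtain t where t: "t < N" "p $ t \<noteq> 0"
    using p by (metis carrier_vecD eq_vecI index_zero_vec(1) index_zero_vec(2))
  have "det (M (unit_vec N t)) \<noteq> 0"
  proof
    assume "det (M (unit_vec N t)) = 0"
    then obtain v where v: "v \<in> carrier_vec N" "v \<noteq> 0\<^sub>v N" "M (unit_vec N t) *\<^sub>v v = 0\<^sub>v N"
      using det_0_iff_vec_prod_zero_field[OF M] by auto
    have row: "((unit_vec N t # rs) ! i) \<bullet> v = 0" if "i < N" for i
    proof -
      have "(unit_vec N t # rs) ! i \<in> carrier_vec N"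
        using that len rs by (cases i) auto
      then have "row (M (unit_vec N t)) i = (unit_vec N t # rs) ! i"
        using that len by (simp add: M_def)
      moreover have "row (M (unit_vec N t)) i \<bullet> v = 0"
        using arg_cong[OF v(3), of "\<lambda>x. x $ i"] that M[of "unit_vec N t"] by simp
      ultimately show ?thesis by simp
    qed
    have "r \<bullet> v = 0" if "r \<in> set rs" for r
      using that row[of "Suc _"] len by (auto simp: in_set_conv_nth)
    then obtain a where a: "v = a \<cdot>\<^sub>v p" using ker v(1) by blast
    have "v $ t = 0" using row[of 0] t v(1) by simp
    then have "a = 0" using a t p(1) by simp
    then have "v = 0\<^sub>v N" using a p(1) by auto
    with v(2) show False ..
  qed
  moreover have "det (M (unit_vec N t)) = k * p $ t"
    using t p(1) by (simp add: det_M k)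
  ultimately have "k \<noteq> 0" by auto
  moreover have "cofactor (M u) 0 s = k * p $ s" if "s < N" for s
    using arg_cong[OF k, of "\<lambda>x. x $ s"] that p(1) by (simp add: c_def)
  ultimately show thesis using that by (auto simp: M_def)
qed

section \<open>Determinants with a row of powers above constant rows\<close>

lemma (in comm_ring_hom) cofactor_hom:
  assumes "A \<in> carrier_mat n n" and "i < n" and "j < n"
  shows "cofactor (map_mat hom A) i j = hom (cofactor A i j)"
proof -
  have "mat_delete (map_mat hom A) i j = map_mat hom (mat_delete A i j)"
    using assms by (intro eq_matI) (auto simp: mat_delete_def)
  then show ?thesis by (simp add: cofactor_def hom_distribs)
qed

text \<open>All rows below the top one are constant, so the top cofactors are constants and become
  the coefficients of the determinant. They annihilate the rows of the blocks, and
  \<open>ker\<close> places every such coefficient vector on the line of \<open>p\<close>.\<close>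

lemma det_powers_over_blocks:
  assumes square: "powers_over_blocks N As \<in> carrier_mat N N"
    and cols: "\<And>A. A \<in> set As \<Longrightarrow> dim_col A = N"
    and p: "p \<noteq> 0" "degree p < N"
    and ker: "\<And>q. degree q < N \<Longrightarrow>
      (\<And>A. A \<in> set As \<Longrightarrow> A *\<^sub>v vec N (coeff q) = 0\<^sub>v (dim_row A)) \<Longrightarrow> \<exists>c. q = smult c p"
  obtains k where "k \<noteq> 0" and "det (powers_over_blocks N As) = smult k p"
proof -
  define rs where "rs = concat (map rows As)"
  define u :: "complex poly vec" where "u = vec N (monom 1)"
  \<comment> \<open>A constant dummy top row: \<open>u\<close> is not an image under
    \<open>h\<close>, but with \<open>z\<close> in its place the whole matrix is, and the cofactors
    of row 0 stay the same.\<close>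
  define z :: "complex vec" where "z = 0\<^sub>v N"
  define h :: "complex \<Rightarrow> complex poly" where "h = (\<lambda>c. [:c:])"
  interpret h: comm_ring_hom h
    by unfold_locales (simp_all add: h_def)
  have pob: "powers_over_blocks N As = mat_of_rows N (u # map (map_vec h) rs)"
    by (simp add: powers_over_blocks_def u_def h_def rs_def)
  have len: "Suc (length rs) = N"
    using carrier_matD(1)[OF square] by (simp add: pob)
  have rs: "set rs \<subseteq> carrier_vec N"
  proof
    fix r assume "r \<in> set rs"
    then obtain A where "A \<in> set As" "r \<in> set (rows A)" by (auto simp: rs_def)
    then show "r \<in> carrier_vec N" using cols rows_carrier by blast
  qed
  have cofactor_h: "cofactor (mat_of_rows N (u # map (map_vec h) rs)) 0 s =
      h (cofactor (mat_of_rows N (z # rs)) 0 s)" if "s < N" for s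
  proof -
    have "cofactor (mat_of_rows N (u # map (map_vec h) rs)) 0 s =
        cofactor (mat_of_rows N (map (map_vec h) (z # rs))) 0 s"
      using that len by (simp add: cofactor_mat_of_rows_Cons[of _ N s u "map_vec h z"])
    also have "mat_of_rows N (map (map_vec h) (z # rs)) = map_mat h (mat_of_rows N (z # rs))"
      by (rule mat_of_rows_map) (use rs in \<open>simp add: z_def\<close>)
    also have "cofactor \<dots> 0 s = h (cofactor (mat_of_rows N (z # rs)) 0 s)"
      using that len by (intro h.cofactor_hom[of _ N]) (auto intro!: carrier_matI)
    finally show ?thesis .
  qed
  have "\<exists>c. v = c \<cdot>\<^sub>v vec N (coeff p)"
    if v: "v \<in> carrier_vec N" and orth: "\<And>r. r \<in> set rs \<Longrightarrow> r \<bullet> v = 0" for v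
  proof -
    define q where "q = Poly (list_of_vec v)"
    have coeff_q: "coeff q s = (if s < N then v $ s else 0)" for s
      using v by (auto simp: q_def coeff_Poly_eq nth_default_def list_of_vec_index)
    have q: "vec N (coeff q) = v"
      using v by (auto simp: coeff_q)
    have "degree q < N"
      using len by (intro degree_lessI) (auto simp: coeff_q)
    moreover have "A *\<^sub>v vec N (coeff q) = 0\<^sub>v (dim_row A)" if "A \<in> set As" for A
    proof (rule eq_vecI)
      fix i assume i: "i < dim_vec (0\<^sub>v (dim_row A))"
      then have "row A i \<in> set (rows A)"
        by (simp add: rows_def)
      then have "row A i \<in> set rs"
        using that by (auto simp: rs_def)
      then show "(A *\<^sub>v vec N (coeff q)) $ i = 0\<^sub>v (dim_row A) $ i"
        using i orth by (simp add: q)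
    qed simp
    ultimately obtain c where "q = smult c p" using ker by blast
    then have "v = c \<cdot>\<^sub>v vec N (coeff p)"
      unfolding q[symmetric] by auto
    then show ?thesis ..
  qed
  moreover have "vec N (coeff p) \<noteq> 0\<^sub>v N"
    using p by (metis index_vec index_zero_vec(1) leading_coeff_0_iff)
  ultimately obtain k where k: "k \<noteq> 0"
      "\<And>s. s < N \<Longrightarrow> cofactor (mat_of_rows N (z # rs)) 0 s = k * vec N (coeff p) $ s"
    using cofactor_top_row_proportional[OF len rs, of "vec N (coeff p)" z] by auto
  have "det (powers_over_blocks N As) =
      (\<Sum>s<N. u $ s * cofactor (mat_of_rows N (u # map (map_vec h) rs)) 0 s)"
    unfolding pob by (rule det_mat_of_rows_Cons) (simp add: len)
  also have "\<dots> = (\<Sum>s<N. monom (k * coeff p s) s)"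
  proof (rule sum.cong)
    fix s assume "s \<in> {..<N}"
    then have s: "s < N" by simp
    have "u $ s * h (k * coeff p s) = monom (k * coeff p s) s"
      using s by (simp add: u_def h_def smult_monom)
    then show "u $ s * cofactor (mat_of_rows N (u # map (map_vec h) rs)) 0 s =
        monom (k * coeff p s) s"
      using s by (simp add: cofactor_h k(2))
  qed simp
  also have "\<dots> = smult k p"
    using p(2) by (intro poly_eqI) (auto simp: coeff_sum intro: coeff_eq_0)
  finally show thesis using k(1) that by blast
qed

section \<open>Reducing Pade tuples to their denominators\<close>

text \<open>The factor \<open>w\<close> in front of \<open>P 0\<close> is moved to the series, which
  gives the order conditions one form for all \<open>j\<close>.\<close>

definition pade_series :: "(nat \<Rightarrow> complex fps) \<Rightarrow> nat \<Rightarrow> nat \<Rightarrow> complex fps" where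
  "pade_series f j i = (if 1 \<le> j \<and> j \<le> i then f i * fps_X else f i)"

definition pade_degree :: "nat \<Rightarrow> nat \<Rightarrow> nat \<Rightarrow> nat \<Rightarrow> nat" where
  "pade_degree L n j i = n * (L - 1) - 1 + (if i = j then 1 else 0)"

lemma pade_degree_less:
  assumes "2 \<le> L" and "1 \<le> n"
  shows "pade_degree L n j i < n * L"
  using assms by (cases L) (auto simp: pade_degree_def)

lemma pade_tuple_iff:
  assumes "f 0 = 1" and "j < L"
  shows "pade_tuple L n f j Q \<longleftrightarrow> (\<exists>i<L. Q i \<noteq> 0) \<and> (\<forall>i<L. degree (Q i) \<le> pade_degree L n j i) \<and>
    (\<forall>i\<in>{1..<L}. vanishes_to_order (n * L)
      (fps_of_poly (Q i) - pade_series f j i * fps_of_poly (Q 0)))"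
proof (cases "j = 0")
  case True
  then show ?thesis using assms by (simp add: pade_tuple_def pade_degree_def pade_series_def)
next
  case False
  then have "{1..<L} = {1..<j} \<union> {j..<L}" using assms by auto
  then show ?thesis using False assms(1)
    by (simp add: pade_tuple_def pade_degree_def pade_series_def mult.assoc ball_Un)
qed

text \<open>What is left of the Pade conditions once the \<open>Q i\<close> with
  \<open>1 \<le> i\<close> are eliminated: linear equations for the coefficients in the gap between
  degree bound and order of vanishing.\<close>

definition pade_denominator :: "nat \<Rightarrow> nat \<Rightarrow> (nat \<Rightarrow> complex fps) \<Rightarrow> nat \<Rightarrow> complex poly \<Rightarrow> bool" where
  "pade_denominator L n f j q \<longleftrightarrow> degree q \<le> pade_degree L n j 0 \<and>
     (\<forall>i\<in>{1..<L}. \<forall>k. pade_degree L n j i < k \<longrightarrow> k < n * L \<longrightarrow>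
        fps_nth (pade_series f j i * fps_of_poly q) k = 0)"

lemma pade_tuple_denominator:
  assumes "2 \<le> L" and "1 \<le> n" and "f 0 = 1" and "j < L" and Q: "pade_tuple L n f j Q"
  shows "pade_denominator L n f j (Q 0)" and "Q 0 \<noteq> 0"
proof -
  note Q = Q[unfolded pade_tuple_iff[of f, OF \<open>f 0 = 1\<close> \<open>j < L\<close>]]
  have eq: "coeff (Q i) k = fps_nth (pade_series f j i * fps_of_poly (Q 0)) k"
    if "i \<in> {1..<L}" "k < n * L" for i k
    using Q that by (auto simp: vanishes_to_order_def)
  show "pade_denominator L n f j (Q 0)"
    unfolding pade_denominator_def
  proof (intro conjI ballI allI impI)
    show "degree (Q 0) \<le> pade_degree L n j 0" using Q assms by auto
    fix i k assume i: "i \<in> {1..<L}" and k: "pade_degree L n j i < k" "k < n * L"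
    have "degree (Q i) < k" using Q i k by fastforce
    then show "fps_nth (pade_series f j i * fps_of_poly (Q 0)) k = 0"
      using eq[OF i k(2)] by (simp add: coeff_eq_0)
  qed
  show "Q 0 \<noteq> 0"
  proof
    assume 0: "Q 0 = 0"
    have "Q i = 0" if i: "i < L" for i
    proof (cases "i = 0")
      case False
      \<comment> \<open>Degree bounds lie below \<open>n * L\<close>, so the order condition reaches
        the leading coefficient and equates it with a coefficient of 0.\<close>
      have "coeff (Q i) (degree (Q i)) = 0"
      proof (subst eq)
        have "degree (Q i) \<le> pade_degree L n j i" using Q i by blast
        then show "degree (Q i) < n * L" using pade_degree_less[OF assms(1,2)] le_less_trans by blast
      qed (use i False 0 in auto)
      then show ?thesis by simp
    qed (simp add: 0)
    with Q show False by blast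
  qed
qed

text \<open>The numerators are recovered by truncating each series at its degree bound; the gap
  conditions make the error start only at order \<open>n * L\<close>.\<close>

lemma pade_denominator_tuple:
  assumes "f 0 = 1" and "j < L"
    and q: "pade_denominator L n f j q" "q \<noteq> 0"
  obtains Q where "pade_tuple L n f j Q" and "Q 0 = q"
proof -
  define Q where "Q i = (if i = 0 then q else
    \<Sum>k\<le>pade_degree L n j i. monom (fps_nth (pade_series f j i * fps_of_poly q) k) k)" for i
  have coeff_Q: "coeff (Q i) k =
      (if k \<le> pade_degree L n j i then fps_nth (pade_series f j i * fps_of_poly q) k else 0)"
    if "i \<noteq> 0" for i k
    using that by (auto simp: Q_def coeff_sum)
  have "pade_tuple L n f j Q"
    unfolding pade_tuple_iff[of f, OF \<open>f 0 = 1\<close> \<open>j < L\<close>]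
  proof (intro conjI allI ballI impI)
    show "\<exists>i<L. Q i \<noteq> 0" using assms by (intro exI[of _ 0]) (auto simp: Q_def)
    show "degree (Q i) \<le> pade_degree L n j i" for i
    proof (cases "i = 0")
      case True
      then show ?thesis using q by (simp add: Q_def pade_denominator_def)
    next
      case False
      then show ?thesis by (intro degree_le) (auto simp: coeff_Q)
    qed
    fix i assume "i \<in> {1..<L}"
    then show "vanishes_to_order (n * L)
        (fps_of_poly (Q i) - pade_series f j i * fps_of_poly (Q 0))"
      using q by (auto simp: vanishes_to_order_def coeff_Q pade_denominator_def Q_def[of 0])
  qed
  then show thesis using that by (simp add: Q_def)
qed

section \<open>Toeplitz blocks as linear equations\<close>

lemma toeplitz_mult_coeff_vec:
  fixes g :: "'a::comm_semiring_0 fps"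
  assumes "degree q < N" and "r < k"
  shows "(toeplitz g J k N *\<^sub>v vec N (coeff q)) $ r = fps_nth (g * fps_of_poly q) (J + r)"
proof -
  have "(toeplitz g J k N *\<^sub>v vec N (coeff q)) $ r =
      (\<Sum>s<N. fps_nth_int g (int J + int r - int s) * coeff q s)"
    using assms by (simp add: toeplitz_def scalar_prod_def atLeast0LessThan)
  also have "\<dots> = (\<Sum>s\<le>J + r. fps_nth g (J + r - s) * coeff q s)"
    \<comment> \<open>The two ranges differ only in zero terms: for \<open>s > J + r\<close> the
      Toeplitz index is negative, and for \<open>s \<ge> N\<close> the coefficient of
      \<open>q\<close> vanishes.\<close>
    by (rule sum.mono_neutral_cong)
      (use assms in \<open>auto simp: fps_nth_int_def coeff_eq_0 nat_diff_distrib
        simp flip: of_nat_add of_nat_diff\<close>)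
  also have "\<dots> = fps_nth (fps_of_poly q * g) (J + r)"
    by (simp add: fps_mult_nth atLeast0AtMost mult.commute[of "fps_nth g _"])
  finally show ?thesis by (simp add: mult.commute)
qed

text \<open>One row per coefficient in the gap, one column per coefficient of the denominator. The
  starting index is the first one in the gap, lowered by 1 where a factor \<open>w\<close> shifts
  the series. For \<open>i = j \<ge> 1\<close> the larger degree bound costs one row and cancels
  this shift.\<close>

definition pade_block :: "nat \<Rightarrow> nat \<Rightarrow> (nat \<Rightarrow> complex fps) \<Rightarrow> nat \<Rightarrow> nat \<Rightarrow> complex mat" where
  "pade_block L n f j i =
     toeplitz (f i) (Suc (pade_degree L n j i) - (if 1 \<le> j \<and> j \<le> i then 1 else 0))
       (n * L - Suc (pade_degree L n j i)) (Suc (pade_degree L n j 0))"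

text \<open>Only the set of blocks is recorded, since their order does not matter for the common
  kernel.\<close>

lemma pade_matrix_blocks:
  assumes "2 \<le> L" and "1 \<le> n" and "j < L"
  obtains As where "pade_matrix L n f j = powers_over_blocks (Suc (pade_degree L n j 0)) As"
    and "set As = pade_block L n f j ` {1..<L}"
proof -
  let ?T = "pade_block L n f j"
  define m where "m = n * (L - 1)"
  have m: "0 < m" "n * L = m + n"
    using assms by (cases L; auto simp: m_def)+
  have Suc_degree: "Suc (pade_degree L n j i) = (if i = j then m + 1 else m)" for i
    using m(1) unfolding pade_degree_def m_def[symmetric] by simp
  have matrix: "pade_matrix L n f j =
      (if j = 0 then powers_over_blocks (m + 1) (map (\<lambda>i. toeplitz (f i) m n (m + 1)) [1..<L])
       else powers_over_blocks m
         (map (\<lambda>i. toeplitz (f i) m n m) [1..<j] @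
          [toeplitz (f j) m (n - 1) m] @
          map (\<lambda>i. toeplitz (f i) (m - 1) n m) [j + 1..<L]))"
    unfolding pade_matrix_def Let_def m_def[symmetric] ..
  show thesis
  proof (cases "j = 0")
    case True
    show thesis
    proof (rule that)
      show "pade_matrix L n f j = powers_over_blocks (Suc (pade_degree L n j 0))
          (map (\<lambda>i. toeplitz (f i) m n (m + 1)) [1..<L])"
        unfolding matrix Suc_degree using True by simp
      have "(\<lambda>i. toeplitz (f i) m n (m + 1)) ` {1..<L} = ?T ` {1..<L}"
        unfolding pade_block_def Suc_degree using True m(2) by (intro image_cong) auto
      then show "set (map (\<lambda>i. toeplitz (f i) m n (m + 1)) [1..<L]) = ?T ` {1..<L}"
        by simp
    qed
  next
    case False
    have split: "{1..<L} = {1..<j} \<union> {j} \<union> {j + 1..<L}"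
      using False assms by auto
    show thesis
    proof (rule that)
      show "pade_matrix L n f j = powers_over_blocks (Suc (pade_degree L n j 0))
          (map (\<lambda>i. toeplitz (f i) m n m) [1..<j] @
           [toeplitz (f j) m (n - 1) m] @
           map (\<lambda>i. toeplitz (f i) (m - 1) n m) [j + 1..<L])"
        using False by (simp add: matrix Suc_degree)
      have "(\<lambda>i. toeplitz (f i) m n m) ` {1..<j} = ?T ` {1..<j}"
        using False m(2) by (intro image_cong) (auto simp: pade_block_def Suc_degree)
      moreover have "toeplitz (f j) m (n - 1) m = ?T j"
        using False m(2) by (simp add: pade_block_def Suc_degree)
      moreover have "(\<lambda>i. toeplitz (f i) (m - 1) n m) ` {j + 1..<L} = ?T ` {j + 1..<L}"
        using False m(2) by (intro image_cong) (auto simp: pade_block_def Suc_degree)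
      ultimately show "set (map (\<lambda>i. toeplitz (f i) m n m) [1..<j] @
           [toeplitz (f j) m (n - 1) m] @
           map (\<lambda>i. toeplitz (f i) (m - 1) n m) [j + 1..<L]) = ?T ` {1..<L}"
        unfolding split image_Un by (simp del: upt_Suc)
    qed
  qed
qed

section \<open>Kernel vectors as denominators, and uniqueness\<close>

lemma det_pade_matrix:
  assumes L: "2 \<le> L" and n: "1 \<le> n" and f: "f 0 = 1" and j: "j < L"
    and P: "pade_tuple L n f j P" and unique: "unique_pade_tuple L n f j"
  obtains k where "k \<noteq> 0" and "det (pade_matrix L n f j) = smult k (P 0)"
proof -
  let ?d = "pade_degree L n j"
  let ?N = "Suc (?d 0)"
  obtain As where As: "pade_matrix L n f j = powers_over_blocks ?N As" "set As = pade_block L n f j ` {1..<L}"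
    using pade_matrix_blocks[OF L n j] .
  have N: "?N = (if j = 0 then n * (L - 1) + 1 else n * (L - 1))"
    using L n by (auto simp: pade_degree_def)
  have P0: "pade_denominator L n f j (P 0)" "P 0 \<noteq> 0"
    using pade_tuple_denominator[where f = f, OF L n f j P] by auto
  have square: "powers_over_blocks ?N As \<in> carrier_mat ?N ?N"
    unfolding As(1)[symmetric] unfolding N using pade_matrix_0_carrier pade_matrix_carrier n j by auto
  have kernel: "\<exists>c. q = smult c (P 0)"
    if q: "degree q < ?N" "\<And>A. A \<in> set As \<Longrightarrow> A *\<^sub>v vec ?N (coeff q) = 0\<^sub>v (dim_row A)" for q
  \<comment> \<open>The zero polynomial is treated apart, since only a nonzero denominator is
    extended to a Pade tuple.\<close>
  proof (cases "q = 0")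
    case False
    have "fps_nth (pade_series f j i * fps_of_poly q) k = 0"
      if i: "i \<in> {1..<L}" and k: "?d i < k" "k < n * L" for i k
    proof -
      have r: "k - Suc (?d i) < n * L - Suc (?d i)" using k by simp
      have "(pade_block L n f j i *\<^sub>v vec ?N (coeff q)) $ (k - Suc (?d i)) = 0"
        using q(2)[of "pade_block L n f j i"] i r As(2) by (simp add: pade_block_def)
      then show ?thesis
        \<comment> \<open>Row \<open>k - Suc (?d i)\<close> yields coefficient \<open>k\<close> of
          \<open>f i * q\<close>, or coefficient \<open>k - 1\<close> in the shifted case, which is
          coefficient \<open>k\<close> after multiplication by \<open>w\<close>.\<close>
        unfolding pade_block_def toeplitz_mult_coeff_vec[OF q(1) r]
        using k by (auto simp: pade_series_def mult.assoc mult.left_commute[of "f i" fps_X] split: if_splits)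
    qed
    then have "pade_denominator L n f j q"
      using q(1) by (simp add: pade_denominator_def)
    then obtain Q where "pade_tuple L n f j Q" "Q 0 = q"
      using pade_denominator_tuple[where f = f, OF f j _ False] by blast
    \<comment> \<open>Uniqueness concerns whole tuples; its component at index 0 is the
      claim.\<close>
    then show ?thesis using unique P L unfolding unique_pade_tuple_def by fastforce
  qed (auto intro: exI[of _ 0])
  have cols: "dim_col A = ?N" if "A \<in> set As" for A
    using that As(2) by (auto simp: pade_block_def)
  have "degree (P 0) < ?N"
    using P0(1) by (simp add: pade_denominator_def)
  then obtain k where "k \<noteq> 0" "det (powers_over_blocks ?N As) = smult k (P 0)"
    using det_powers_over_blocks[OF square cols P0(2) _ kernel] by blast
  then show thesis
    using that As(1) by simp
qed

theorem proposition2p3: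
  fixes L n :: nat
    and f :: "nat \<Rightarrow> complex fps"
    and P :: "nat \<Rightarrow> nat \<Rightarrow> complex poly"
  assumes "2 \<le> L" and "1 \<le> n"
    and "f 0 = 1"
    and "\<And>j. j < L \<Longrightarrow> pade_tuple L n f j (P j)"
    and "\<And>j. j < L \<Longrightarrow> unique_pade_tuple L n f j"
  shows "\<exists>NP :: nat \<Rightarrow> complex. \<forall>j<L. NP j \<noteq> 0 \<and>
           P j 0 = smult (1 / NP j) (det (pade_matrix L n f j))"
proof -
  have "\<exists>k. k \<noteq> 0 \<and> P j 0 = smult (1 / k) (det (pade_matrix L n f j))" if j: "j < L" for j
  proof -
    obtain k where "k \<noteq> 0" "det (pade_matrix L n f j) = smult k (P j 0)"
      using det_pade_matrix[where f = f, OF assms(1-3) j assms(4,5)[OF j]] .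
    then show ?thesis by auto
  qed
  then show ?thesis by metis
qed

end
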